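(* Let $n\ge 2$ be an even integer. The resolving polynomial of $\Delta(SD_{8n})$ is \[\beta(\Delta(SD_{8n}),x)=x^{8n}+8n\,x^{8n-1}+2^{2n+2}(2n-1)x^{6n-2}+\sum_{i=6n-1}^{8n-2}r_i x^i,\] where \[r_i=2^{8n-i}\left\{\binom{2n+1}{8n-i}+(2n-1)\binom{2n+1}{8n-i-1}\right\}\quad\text{for } 6n-1\le i\le 8n-2.\]
   Context: For an integer $n\ge 2$, the semidihedral group is $SD_{8n}=\langle a,b : a^{4n}=b^2=e,\ ba=a^{2n-1}b\rangle$, a group of order $8n$. The commuting graph $\Delta(G)$ of a group $G$ is the simple graph with vertex set $G$ in which two distinct vertices $x,y$ are adjacent iff $xy=yx$. A vertex $z$ of a connected graph $\Gamma$ resolves vertices $u,v$ if $d(z,u)\ne d(z,v)$, where $d$ is the graph distance. A set $U$ of vertices is a resolving set if every pair of distinct vertices is resolved by some vertex of $U$. The metric dimension $\dim(\Gamma)$ is the least cardinality of a resolving set. The resolving polynomial of a graph $\Gamma$ of order $N$ is $\beta(\Gamma,x)=\sum_{i=\dim(\Gamma)}^{N} r_i x^i$, where $r_i$ is the number of resolving sets of $\Gamma$ of cardinality $i$. *)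

theory Defs
  imports
    "HOL-Algebra.Group"
    "HOL-Computational_Algebra.Polynomial"
    "Graph_Theory.Graph_Theory"
begin

section \<open>Groups given by a presentation\<close>

text \<open>
  A word over the generators \<open>'g\<close> and their formal inverses: the letter \<open>(x, True)\<close> stands for
  \<open>x\<close> and \<open>(x, False)\<close> for the inverse of \<open>x\<close>.
\<close>

type_synonym 'g word = "('g \<times> bool) list"

text \<open>
  The least congruence on words that contains the given relations and cancels a letter against
  its inverse. The quotient by it is the free group on \<open>'g\<close> modulo the normal closure of the
  relations.
\<close>

inductive word_eq :: "('g word \<times> 'g word) set \<Rightarrow> 'g word \<Rightarrow> 'g word \<Rightarrow> bool"
  for R :: "('g word \<times> 'g word) set" where
  relator: "(u, v) \<in> R \<Longrightarrow> word_eq R u v"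
| cancel: "word_eq R [(x, s), (x, \<not> s)] []"
| refl: "word_eq R u u"
| sym: "word_eq R u v \<Longrightarrow> word_eq R v u"
| trans: "word_eq R u v \<Longrightarrow> word_eq R v w \<Longrightarrow> word_eq R u w"
| append: "word_eq R u v \<Longrightarrow> word_eq R u' v' \<Longrightarrow> word_eq R (u @ u') (v @ v')"

definition word_class :: "('g word \<times> 'g word) set \<Rightarrow> 'g word \<Rightarrow> 'g word set" where
  "word_class R u = {v. word_eq R u v}"

definition presented_group :: "('g word \<times> 'g word) set \<Rightarrow> 'g word set monoid" where
  "presented_group R =
     \<lparr> carrier = range (word_class R),
       monoid.mult = (\<lambda>X Y. \<Union>u\<in>X. \<Union>v\<in>Y. word_class R (u @ v)),
       monoid.one = word_class R [] \<rparr>"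

lemma word_class_eq_iff: "word_class R u = word_class R v \<longleftrightarrow> word_eq R u v"
  unfolding word_class_def by (blast intro: word_eq.refl word_eq.sym word_eq.trans)

lemma presented_group_mult:
  "word_class R u \<otimes>\<^bsub>presented_group R\<^esub> word_class R v = word_class R (u @ v)"
proof -
  have "word_class R (u' @ v') = word_class R (u @ v)"
    if "u' \<in> word_class R u" "v' \<in> word_class R v" for u' v'
    using that unfolding word_class_eq_iff
    by (intro word_eq.append) (simp_all add: word_class_def word_eq.sym)
  moreover have "u \<in> word_class R u" "v \<in> word_class R v"
    by (auto simp: word_class_def intro: word_eq.refl)
  ultimately show ?thesis
    unfolding presented_group_def monoid.simps by blast
qed

lemma word_eq_inverse: "word_eq R (rev (map (\<lambda>(x, s). (x, \<not> s)) u) @ u) []"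
proof (induction u)
  case Nil
  show ?case by (simp add: word_eq.refl)
next
  case (Cons l u)
  obtain x s where l: "l = (x, s)" by (cases l)
  let ?i = "rev (map (\<lambda>(x, s). (x, \<not> s)) u)"
  have "word_eq R ([(x, \<not> s), (x, s)] @ u) ([] @ u)"
    using word_eq.cancel[of R x "\<not> s"] by (intro word_eq.append[OF _ word_eq.refl]) simp
  hence "word_eq R (?i @ ([(x, \<not> s), (x, s)] @ u)) (?i @ ([] @ u))"
    by (rule word_eq.append[OF word_eq.refl])
  hence "word_eq R (?i @ ([(x, \<not> s), (x, s)] @ u)) []"
    by (rule word_eq.trans) (use Cons in simp)
  thus ?case by (simp add: l)
qed

lemma group_presented_group: "group (presented_group R)"
proof (rule groupI)
  fix X assume "X \<in> carrier (presented_group R)"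
  then obtain u where "X = word_class R u" by (auto simp: presented_group_def)
  thus "\<exists>Y\<in>carrier (presented_group R). Y \<otimes>\<^bsub>presented_group R\<^esub> X = \<one>\<^bsub>presented_group R\<^esub>"
    using word_eq_inverse[of R u]
    by (intro bexI[of _ "word_class R (rev (map (\<lambda>(x, s). (x, \<not> s)) u))"])
       (simp add: presented_group_mult, auto simp: presented_group_def word_class_eq_iff)
next
  fix X assume "X \<in> carrier (presented_group R)"
  then obtain u where "X = word_class R u" by (auto simp: presented_group_def)
  thus "\<one>\<^bsub>presented_group R\<^esub> \<otimes>\<^bsub>presented_group R\<^esub> X = X"
    using presented_group_mult[of R "[]" u] by (simp add: presented_group_def)
next
  fix X Y Z
  assume "X \<in> carrier (presented_group R)" "Y \<in> carrier (presented_group R)"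
    "Z \<in> carrier (presented_group R)"
  then obtain u v w where "X = word_class R u" "Y = word_class R v" "Z = word_class R w"
    by (auto simp: presented_group_def)
  thus "X \<otimes>\<^bsub>presented_group R\<^esub> Y \<otimes>\<^bsub>presented_group R\<^esub> Z = X \<otimes>\<^bsub>presented_group R\<^esub> (Y \<otimes>\<^bsub>presented_group R\<^esub> Z)"
    by (simp add: presented_group_mult)
next
  fix X Y
  assume "X \<in> carrier (presented_group R)" "Y \<in> carrier (presented_group R)"
  then obtain u v where "X = word_class R u" "Y = word_class R v"
    by (auto simp: presented_group_def)
  thus "X \<otimes>\<^bsub>presented_group R\<^esub> Y \<in> carrier (presented_group R)"
    by (simp add: presented_group_mult) (simp add: presented_group_def)
qed (simp add: presented_group_def)


section \<open>The semidihedral groups\<close>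

datatype sd_gen = Gen_a | Gen_b

definition pow_a :: "nat \<Rightarrow> sd_gen word" where
  "pow_a k = replicate k (Gen_a, True)"

definition pow_b :: "nat \<Rightarrow> sd_gen word" where
  "pow_b k = replicate k (Gen_b, True)"

text \<open>\<open>\<langle>a, b | a\<^sup>4\<^sup>n = b\<^sup>2 = e, b a = a\<^sup>2\<^sup>n\<^sup>-\<^sup>1 b\<rangle>\<close>; the exponent \<open>2 * n - 1\<close> is only meaningful for \<open>n \<ge> 1\<close>.\<close>

definition semidihedral_group :: "nat \<Rightarrow> sd_gen word set monoid" where
  "semidihedral_group n = presented_group
     {(pow_a (4 * n), []),
      (pow_b 2, []),
      (pow_b 1 @ pow_a 1, pow_a (2 * n - 1) @ pow_b 1)}"


section \<open>Commuting graphs\<close>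

text \<open>A simple graph is a loop-free digraph whose arc set is symmetric.\<close>

definition commuting_graph :: "('a, 'b) monoid_scheme \<Rightarrow> 'a pair_pre_digraph" where
  "commuting_graph G =
     \<lparr> pverts = carrier G,
       parcs = {(x, y). x \<in> carrier G \<and> y \<in> carrier G \<and> x \<noteq> y \<and> x \<otimes>\<^bsub>G\<^esub> y = y \<otimes>\<^bsub>G\<^esub> x} \<rparr>"

lemma pair_bidirected_digraph_commuting_graph: "pair_bidirected_digraph (commuting_graph G)"
proof
  show "fst e \<in> pverts (commuting_graph G)" "snd e \<in> pverts (commuting_graph G)"
    "fst e \<noteq> snd e"
    if "e \<in> parcs (commuting_graph G)" for e
    using that by (auto simp: commuting_graph_def)
  show "symmetric (with_proj (commuting_graph G))"
    unfolding symmetric_def with_proj_simps by (rule symI) (auto simp: commuting_graph_def)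
qed


section \<open>Metric dimension and resolving polynomial\<close>

text \<open>The graph distance is the shortest-path distance for arcs of weight 1.\<close>

definition graph_dist :: "'a pair_pre_digraph \<Rightarrow> 'a \<Rightarrow> 'a \<Rightarrow> ereal" where
  "graph_dist \<Gamma> u v = wf_digraph.\<mu> (with_proj \<Gamma>) (\<lambda>_. 1) u v"

definition resolving_set :: "'a pair_pre_digraph \<Rightarrow> 'a set \<Rightarrow> bool" where
  "resolving_set \<Gamma> U \<longleftrightarrow> U \<subseteq> pverts \<Gamma> \<and>
     (\<forall>u\<in>pverts \<Gamma>. \<forall>v\<in>pverts \<Gamma>. u \<noteq> v \<longrightarrow> (\<exists>z\<in>U. graph_dist \<Gamma> z u \<noteq> graph_dist \<Gamma> z v))"

text \<open>Finiteness is required because \<open>card\<close> is \<open>0\<close> on infinite sets.\<close>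

definition metric_dim :: "'a pair_pre_digraph \<Rightarrow> nat" where
  "metric_dim \<Gamma> = (LEAST k. \<exists>U. resolving_set \<Gamma> U \<and> finite U \<and> card U = k)"

definition num_resolving_sets :: "'a pair_pre_digraph \<Rightarrow> nat \<Rightarrow> nat" where
  "num_resolving_sets \<Gamma> i = card {U. resolving_set \<Gamma> U \<and> finite U \<and> card U = i}"

definition resolving_poly :: "'a pair_pre_digraph \<Rightarrow> int poly" where
  "resolving_poly \<Gamma> =
     (\<Sum>i = metric_dim \<Gamma>..card (pverts \<Gamma>). monom (int (num_resolving_sets \<Gamma> i)) i)"

end

theory Submission
  imports Defs "HOL-Number_Theory.Cong"
begin

text \<open>
  For even \<open>n\<close> the group has centre \<open>{e, a\<^sup>2\<^sup>n}\<close>, and commutation is an equivalence relation on the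
  noncentral elements, with classes the \<open>4 n - 2\<close> noncentral powers of \<open>a\<close> and the \<open>2 n\<close> pairs
  \<open>{a\<^sup>i b, a\<^sup>i\<^sup>+\<^sup>2\<^sup>n b}\<close>. Elements of one class (the centre included) have equal distances to all other
  vertices, so a resolving set omits at most one element of each class; since every class has at
  least two elements, this is also sufficient. The complements of the resolving sets are thus the
  partial transversals of the classes, counted by \<open>(1 + (4 n - 2) x) (1 + 2 x)\<^sup>2\<^sup>n\<^sup>+\<^sup>1\<close>.
\<close>

section \<open>Resolving sets of commuting graphs\<close>

text \<open>The identity commutes with everything, so noncommuting elements are joined by a path of
  length 2 through it and no greater distance occurs.\<close>

lemma graph_dist_commuting_graph:
  assumes xy: "x \<in> carrier G" "y \<in> carrier G" and "group G"
  shows "graph_dist (commuting_graph G) x y =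
    (if x = y then 0 else if x \<otimes>\<^bsub>G\<^esub> y = y \<otimes>\<^bsub>G\<^esub> x then 1 else 2)"
proof -
  interpret group G by fact
  define \<Gamma> where "\<Gamma> = commuting_graph G"
  interpret wf_digraph "with_proj \<Gamma>"
    by unfold_locales (auto simp: \<Gamma>_def commuting_graph_def)
  have verts: "pverts \<Gamma> = carrier G"
    and arc: "(u, v) \<in> parcs \<Gamma> \<longleftrightarrow> u \<in> carrier G \<and> v \<in> carrier G \<and> u \<noteq> v \<and> u \<otimes>\<^bsub>G\<^esub> v = v \<otimes>\<^bsub>G\<^esub> u"
    for u v
    by (auto simp: \<Gamma>_def commuting_graph_def)
  have cost: "awalk_cost (\<lambda>_. 1) p = real (length p)" for p
    by (induction p) auto
  have upper: "graph_dist \<Gamma> x y \<le> ereal (length p)" if "awalk x p y" for p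
    using min_cost_le_walk_cost[OF that, of "\<lambda>_. 1"] by (simp add: graph_dist_def cost)
  \<comment> \<open>\<open>\<mu>\<close> is an infimum over walks, so a lower bound has to be
    checked on every walk, while an upper bound needs only one.\<close>
  have lower: "ereal m \<le> graph_dist \<Gamma> x y" if "\<And>p. awalk x p y \<Longrightarrow> m \<le> real (length p)" for m
    unfolding graph_dist_def \<mu>_def by (rule INF_greatest) (use that in \<open>auto simp: cost\<close>)
  have "graph_dist \<Gamma> x y = (if x = y then 0 else if x \<otimes>\<^bsub>G\<^esub> y = y \<otimes>\<^bsub>G\<^esub> x then 1 else 2)"
  proof (cases "x = y")
    case True
    have "awalk x [] y" using xy True by (simp add: awalk_def verts)
    from upper[OF this] lower[of 0] show ?thesis using True by (simp add: zero_ereal_def)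
  next
    case neq: False
    show ?thesis
    proof (cases "x \<otimes>\<^bsub>G\<^esub> y = y \<otimes>\<^bsub>G\<^esub> x")
      case True
      have "awalk x [(x, y)] y" using xy True neq by (simp add: awalk_def verts arc)
      moreover have "1 \<le> real (length p)" if "awalk x p y" for p
        using that neq by (cases p) (auto simp: awalk_def)
      ultimately have "graph_dist \<Gamma> x y \<le> 1" "1 \<le> graph_dist \<Gamma> x y"
        using upper[of "[(x, y)]"] lower[of 1] by (auto simp: one_ereal_def)
      thus ?thesis using True neq by simp
    next
      case False
      hence "x \<noteq> \<one>\<^bsub>G\<^esub>" "y \<noteq> \<one>\<^bsub>G\<^esub>" using xy by auto
      hence "awalk x [(x, \<one>\<^bsub>G\<^esub>), (\<one>\<^bsub>G\<^esub>, y)] y" using xy by (auto simp: awalk_def verts arc)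
      from upper[OF this] have "graph_dist \<Gamma> x y \<le> 2" by simp
      moreover have "2 \<le> real (length p)" if "awalk x p y" for p
      proof (cases p)
        case Nil
        thus ?thesis using that neq by (simp add: awalk_def)
      next
        case (Cons e q)
        \<comment> \<open>A walk of a single arc would make \<open>x\<close> and \<open>y\<close>
          commute.\<close>
        have "q \<noteq> []" using that Cons False arc[of x y] by (cases e) (auto simp: awalk_def)
        thus ?thesis using Cons by (cases q) auto
      qed
      ultimately show ?thesis using lower[of 2] False neq by (intro antisym) auto
    qed
  qed
  thus ?thesis by (simp add: \<Gamma>_def)
qed

text \<open>Here \<open>c\<close> labels the classes and \<open>k\<close> is the label of the
  centre. By \<open>comm\<close>, elements with equal labels have the same distance to every third
  vertex, so only one of them itself can tell them apart. \<open>twin\<close> and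
  \<open>noncomm\<close> supply the resolving vertices for the converse.\<close>

lemma resolving_set_commuting_graph_iff:
  assumes "group G"
    and comm: "\<And>x y. x \<in> carrier G \<Longrightarrow> y \<in> carrier G \<Longrightarrow>
      x \<otimes>\<^bsub>G\<^esub> y = y \<otimes>\<^bsub>G\<^esub> x \<longleftrightarrow> c x = k \<or> c y = k \<or> c x = c y"
    and twin: "\<And>x. x \<in> carrier G \<Longrightarrow> \<exists>y\<in>carrier G. y \<noteq> x \<and> c y = c x"
    and noncomm: "\<And>x. x \<in> carrier G \<Longrightarrow> c x \<noteq> k \<Longrightarrow> \<exists>y\<in>carrier G. c y \<noteq> k \<and> c y \<noteq> c x"
  shows "resolving_set (commuting_graph G) U \<longleftrightarrow> U \<subseteq> carrier G \<and> inj_on c (carrier G - U)"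
proof -
  let ?V = "carrier G" and ?d = "graph_dist (commuting_graph G)"
  note dist = graph_dist_commuting_graph[OF _ _ \<open>group G\<close>] comm
  have verts: "pverts (commuting_graph G) = ?V" by (simp add: commuting_graph_def)
  show ?thesis
  proof safe
    assume res: "resolving_set (commuting_graph G) U"
    thus "u \<in> ?V" if "u \<in> U" for u using that by (auto simp: resolving_set_def verts)
    show "inj_on c (?V - U)"
    proof (rule inj_onI, rule ccontr)
      fix u v assume uv: "u \<in> ?V - U" "v \<in> ?V - U" "c u = c v" "u \<noteq> v"
      with res obtain z where "z \<in> U" "?d z u \<noteq> ?d z v" "z \<in> ?V"
        unfolding resolving_set_def verts by blast
      thus False using uv by (auto simp: dist split: if_splits)
    qed
  next
    assume U: "U \<subseteq> ?V" and inj: "inj_on c (?V - U)"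
    \<comment> \<open>At most one element per class is omitted, so a twin of an omitted vertex lies
      in \<open>U\<close>.\<close>
    have tw: "\<exists>z\<in>U. z \<noteq> x \<and> c z = c x" if "x \<in> ?V" "x \<notin> U" for x
      using twin[OF that(1)] inj that unfolding inj_on_def by blast
    have resolve: "\<exists>z\<in>U. ?d z u \<noteq> ?d z v"
      if uv: "u \<in> ?V" "v \<in> ?V" "u \<notin> U" "v \<notin> U" "c u \<noteq> k" "c u \<noteq> c v" for u v
    proof (cases "c v = k")
      case False
      \<comment> \<open>A twin of \<open>u\<close> commutes with \<open>u\<close> but not with the
        noncentral \<open>v\<close> of another class.\<close>
      obtain z where z: "z \<in> U" "z \<noteq> u" "c z = c u" using tw uv by blast
      hence "?d z u = 1" "?d z v = 2" using uv False U by (auto simp: dist)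
      thus ?thesis using z by force
    next
      case True
      \<comment> \<open>A central \<open>v\<close> is adjacent to all other vertices, so a twin of
        \<open>u\<close> would not separate the two. A vertex of another noncentral class does: it
        is at distance 2 from \<open>u\<close> and 1 from \<open>v\<close>.\<close>
      obtain w where w: "w \<in> ?V" "c w \<noteq> k" "c w \<noteq> c u" using noncomm uv by blast
      then obtain z where z: "z \<in> U" "c z = c w" using tw by (cases "w \<in> U") blast+
      hence "?d z u = 2" "?d z v = 1" using uv w True U by (auto simp: dist)
      thus ?thesis using z by force
    qed
    have "\<exists>z\<in>U. ?d z u \<noteq> ?d z v" if uv: "u \<in> ?V" "v \<in> ?V" "u \<noteq> v" for u v
    proof -
      consider "u \<in> U" | "v \<in> U" | "u \<notin> U" "v \<notin> U" "c u \<noteq> k" | "u \<notin> U" "v \<notin> U" "c u = k"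
        by blast
      thus ?thesis
      proof cases
        case 1
        thus ?thesis using uv by (intro bexI[of _ u]) (auto simp: dist)
      next
        case 2
        thus ?thesis using uv by (intro bexI[of _ v]) (auto simp: dist)
      next
        case 3
        moreover have "c u \<noteq> c v" using inj uv 3 by (auto simp: inj_on_def)
        ultimately show ?thesis using resolve uv by blast
      next
        \<comment> \<open>Now \<open>u\<close> is central and hence \<open>v\<close> is not, so the
          roles are exchanged.\<close>
        case 4
        moreover have "c u \<noteq> c v" using inj uv 4 by (auto simp: inj_on_def)
        ultimately show ?thesis using resolve[of v u] uv by metis
      qed
    qed
    thus "resolving_set (commuting_graph G) U"
      using U by (auto simp: resolving_set_def verts)
  qed
qed

section \<open>Counting partial transversals\<close>

text \<open>Each fibre contributes either no point or one of its points, which gives the factor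
  \<open>1 + |F| x\<close>. The induction adds one label at a time; \<open>V\<close> is arbitrary
  because removing the fibre \<open>F\<close> shrinks it to \<open>W\<close>.\<close>

lemma card_partial_transversals:
  fixes c :: "'a \<Rightarrow> 'k"
  assumes "finite K" and "finite V" and "c ` V \<subseteq> K"
  shows "card {T. T \<subseteq> V \<and> inj_on c T \<and> card T = m} =
    coeff (\<Prod>\<kappa>\<in>K. [:1, card {x\<in>V. c x = \<kappa>}:]) m"
  using assms
proof (induction K arbitrary: V m rule: finite_induct)
  case empty
  hence "{T. T \<subseteq> V \<and> inj_on c T \<and> card T = m} = (if m = 0 then {{}} else {})" by auto
  thus ?case by (simp add: one_pCons coeff_pCons split: nat.split)
next
  case (insert \<kappa> K)
  define F W where "F = {x\<in>V. c x = \<kappa>}" and "W = {x\<in>V. c x \<noteq> \<kappa>}"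
  define N where "N X m = {T. T \<subseteq> X \<and> inj_on c T \<and> card T = m}" for X m
  define p where "p = (\<Prod>\<kappa>\<in>K. [:1, card {x\<in>W. c x = \<kappa>}:])"
  have fin: "finite F" "finite W" "finite (N W m)" for m
    using insert.prems by (auto simp: F_def W_def N_def)
  have W: "card (N W m) = coeff p m" for m
    unfolding N_def p_def using insert.prems by (intro insert.IH) (auto simp: W_def)
  have "{x\<in>W. c x = k} = {x\<in>V. c x = k}" if "k \<in> K" for k
    using insert.hyps that by (auto simp: W_def)
  hence p: "p = (\<Prod>\<kappa>\<in>K. [:1, card {x\<in>V. c x = \<kappa>}:])" by (simp add: p_def)
  have Vcard: "card (N V m) = coeff ([:1, card F:] * p) m"
  proof (cases m)
    case 0
    have "N X 0 = {{}}" if "finite X" for X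
      using that by (auto simp: N_def intro: finite_subset dest: finite_subset)
    hence "card (N V 0) = card (N W 0)" using insert.prems fin by simp
    thus ?thesis using 0 by (simp add: W)
  next
    case (Suc j)
    \<comment> \<open>Since \<open>c\<close> is injective on \<open>T\<close>, either
      \<open>T\<close> misses \<open>F\<close> or exactly one point of \<open>F\<close> extends a
      transversal of \<open>W\<close> with one element less.\<close>
    have split: "N V m = N W m \<union> (\<lambda>(x, T). insert x T) ` (F \<times> N W j)"
    proof (intro equalityI subsetI)
      fix T assume T: "T \<in> N V m"
      hence "finite T" using insert.prems by (auto simp: N_def intro: finite_subset)
      show "T \<in> N W m \<union> (\<lambda>(x, T). insert x T) ` (F \<times> N W j)"
      proof (cases "T \<inter> F = {}")
        case True
        thus ?thesis using T by (auto simp: N_def W_def F_def)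
      next
        case False
        then obtain x where x: "x \<in> T" "x \<in> F" by auto
        have "T - {x} \<in> N W j"
          using T x \<open>finite T\<close> Suc by (auto simp: N_def W_def F_def inj_on_def)
        moreover have "T = insert x (T - {x})" using x by auto
        ultimately show ?thesis using x by blast
      qed
    next
      fix T assume "T \<in> N W m \<union> (\<lambda>(x, T). insert x T) ` (F \<times> N W j)"
      thus "T \<in> N V m"
      proof
        assume "T \<in> N W m"
        thus ?thesis by (auto simp: N_def W_def)
      next
        assume "T \<in> (\<lambda>(x, T). insert x T) ` (F \<times> N W j)"
        then obtain x S where S: "T = insert x S" "x \<in> F" "S \<in> N W j" by auto
        moreover have "x \<notin> S" "finite S"
          using S fin by (auto simp: N_def F_def W_def intro: finite_subset)
        ultimately show ?thesis using Suc by (auto simp: N_def F_def W_def)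
      qed
    qed
    have inj: "inj_on (\<lambda>(x, T). insert x T) (F \<times> N W j)"
    proof (rule inj_onI, clarify)
      fix x S y T assume A: "x \<in> F" "y \<in> F" "S \<in> N W j" "T \<in> N W j" "insert x S = insert y T"
      \<comment> \<open>Intersecting with the disjoint sets \<open>W\<close> and \<open>F\<close>
        recovers both components.\<close>
      hence "S = insert x S \<inter> W" "T = insert y T \<inter> W" "{x} = insert x S \<inter> F" "{y} = insert y T \<inter> F"
        by (auto simp: F_def W_def N_def)
      thus "x = y \<and> S = T" using A(5) by (metis singleton_inject)
    qed
    have "N W m \<inter> (\<lambda>(x, T). insert x T) ` (F \<times> N W j) = {}"
      by (auto simp: N_def F_def W_def)
    hence "card (N V m) = card (N W m) + card F * card (N W j)"
      unfolding split using fin inj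
      by (subst card_Un_disjoint) (auto simp: card_image card_cartesian_product)
    thus ?thesis using Suc by (simp add: W)
  qed
  show ?case using Vcard insert.hyps by (simp add: N_def F_def p)
qed

text \<open>Taking complements matches resolving sets of size \<open>i\<close> with partial
  transversals of the complementary size.\<close>

lemma num_resolving_sets_eq_coeff:
  assumes res: "\<And>U. resolving_set \<Gamma> U \<longleftrightarrow> U \<subseteq> pverts \<Gamma> \<and> inj_on c (pverts \<Gamma> - U)"
    and fin: "finite (pverts \<Gamma>)" "finite K" and "c ` pverts \<Gamma> \<subseteq> K"
    and i: "i \<le> card (pverts \<Gamma>)"
  shows "num_resolving_sets \<Gamma> i =
    coeff (\<Prod>\<kappa>\<in>K. [:1, card {x \<in> pverts \<Gamma>. c x = \<kappa>}:]) (card (pverts \<Gamma>) - i)"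
proof -
  let ?V = "pverts \<Gamma>"
  have "bij_betw (\<lambda>U. ?V - U) {U. resolving_set \<Gamma> U \<and> finite U \<and> card U = i}
     {T. T \<subseteq> ?V \<and> inj_on c T \<and> card T = card ?V - i}"
  proof (rule bij_betw_byWitness[where f' = "\<lambda>T. ?V - T"], goal_cases)
    case 4
    show ?case
    proof clarify
      fix T assume T: "T \<subseteq> ?V" "inj_on c T" "card T = card ?V - i"
      hence "?V - (?V - T) = T" by blast
      thus "resolving_set \<Gamma> (?V - T) \<and> finite (?V - T) \<and> card (?V - T) = i"
        using T fin i by (simp add: res card_Diff_subset finite_subset)
    qed
  qed (auto simp: res card_Diff_subset)
  hence "num_resolving_sets \<Gamma> i = card {T. T \<subseteq> ?V \<and> inj_on c T \<and> card T = card ?V - i}"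
    unfolding num_resolving_sets_def by (rule bij_betw_same_card)
  thus ?thesis using card_partial_transversals[OF fin(2,1)] assms by simp
qed

section \<open>The semidihedral group in normal form\<close>

definition sd_relations :: "nat \<Rightarrow> (sd_gen word \<times> sd_gen word) set" where
  "sd_relations n =
     {(pow_a (4 * n), []),
      (pow_b 2, []),
      (pow_b 1 @ pow_a 1, pow_a (2 * n - 1) @ pow_b 1)}"

text \<open>The pair \<open>(i, s)\<close> stands for \<open>a\<^sup>i b\<^sup>s\<close>.\<close>

definition sd_mult :: "nat \<Rightarrow> nat \<times> bool \<Rightarrow> nat \<times> bool \<Rightarrow> nat \<times> bool" where
  "sd_mult n = (\<lambda>(i, s) (j, t). ((i + (if s then (2 * n - 1) * j else j)) mod (4 * n), s \<noteq> t))"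

text \<open>Inverse letters receive nonnegative exponents: the inverse of \<open>a\<close> is
  \<open>a^(4n-1)\<close>, and \<open>b\<close> is its own inverse.\<close>

fun sd_letter :: "nat \<Rightarrow> sd_gen \<times> bool \<Rightarrow> nat \<times> bool" where
  "sd_letter n (Gen_a, s) = (if s then 1 else 4 * n - 1, False)"
| "sd_letter n (Gen_b, s) = (0, True)"

fun sd_eval :: "nat \<Rightarrow> sd_gen word \<Rightarrow> nat \<times> bool" where
  "sd_eval n [] = (0, False)"
| "sd_eval n (l # u) = sd_mult n (sd_letter n l) (sd_eval n u)"

fun sd_normal :: "nat \<times> bool \<Rightarrow> sd_gen word" where
  "sd_normal (i, s) = pow_a i @ (if s then pow_b 1 else [])"

lemma pow_a_add: "pow_a (i + j) = pow_a i @ pow_a j"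
  by (simp add: pow_a_def replicate_add)

lemma sd_eval_bound: "n \<ge> 1 \<Longrightarrow> fst (sd_eval n u) < 4 * n"
  by (cases u) (auto simp: sd_mult_def split: prod.splits)

text \<open>Conjugation by \<open>b\<close> multiplies exponents of \<open>a\<close> by
  \<open>2n-1\<close>. It is an involution because \<open>(2n-1)^2 = 1 + (n-1) * 4n\<close>.\<close>

lemma twist_twist:
  fixes n i :: nat
  assumes "n \<ge> 1"
  shows "[(2 * n - 1) * ((2 * n - 1) * i) = i] (mod (4 * n))"
proof -
  obtain m where m: "n = Suc m" using assms by (cases n) auto
  have "(2 * n - 1) * ((2 * n - 1) * i) = i + m * i * (4 * n)"
    by (simp add: m algebra_simps)
  thus ?thesis by (simp add: cong_def)
qed

lemma sd_mult_assoc: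
  assumes "n \<ge> 1"
  shows "sd_mult n (sd_mult n x y) z = sd_mult n x (sd_mult n y z)"
proof -
  obtain i s j t k r where xyz: "x = (i, s)" "y = (j, t)" "z = (k, r)" by (metis surj_pair)
  obtain m where m: "2 * n - 1 = m" by blast
  \<comment> \<open>Needed when both \<open>x\<close> and \<open>y\<close> contain \<open>b\<close>:
    the exponent of \<open>z\<close> is then twisted twice.\<close>
  have "[m * (m * k) = k] (mod (4 * n))" using twist_twist[OF assms, of k] unfolding m .
  hence "[i + m * j + m * (m * k) = i + m * j + k] (mod (4 * n))"
    by (intro cong_add cong_refl)
  hence "(i + (m * j + m * (m * k))) mod (4 * n) = (i + (m * j + k)) mod (4 * n)"
    by (simp add: cong_def add.assoc)
  moreover have "(i + m * (l mod (4 * n))) mod (4 * n) = (i + m * l) mod (4 * n)" for l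
    by (metis mod_add_right_eq mod_mult_right_eq)
  ultimately show ?thesis
    by (cases s; cases t) (simp_all add: xyz sd_mult_def m[simplified] mod_simps distrib_left add.assoc)
qed

lemma sd_eval_append:
  assumes "n \<ge> 1"
  shows "sd_eval n (u @ v) = sd_mult n (sd_eval n u) (sd_eval n v)"
proof (induction u)
  case Nil
  \<comment> \<open>\<open>(0, False)\<close> is a left unit only for pairs with a reduced exponent,
    hence the appeal to \<open>sd_eval_bound\<close>.\<close>
  show ?case using sd_eval_bound[OF assms, of v] by (auto simp: sd_mult_def split: prod.splits)
next
  case (Cons l u)
  thus ?case using assms by (simp add: sd_mult_assoc)
qed

lemma sd_eval_pow_a: "n \<ge> 1 \<Longrightarrow> sd_eval n (pow_a i) = (i mod (4 * n), False)"
  by (induction i) (auto simp: pow_a_def sd_mult_def mod_simps)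

lemma sd_eval_pow_b: "sd_eval n (pow_b 1) = (0, True)" "sd_eval n (pow_b 2) = (0, False)"
  by (simp_all add: pow_b_def sd_mult_def numeral_2_eq_2)

text \<open>The relations and the cancellation of inverse letters hold for \<open>sd_mult\<close>,
  so evaluation is well defined on classes. This is what rules out a collapse of the presented
  group.\<close>

lemma word_eq_imp_sd_eval_eq:
  assumes "n \<ge> 1" and "word_eq (sd_relations n) u v"
  shows "sd_eval n u = sd_eval n v"
  using assms(2)
proof (induction rule: word_eq.induct)
  case (relator u v)
  thus ?case using assms(1)
    by (auto simp: sd_relations_def sd_eval_append sd_eval_pow_a sd_eval_pow_b[simplified] sd_mult_def mod_simps)
next
  case (cancel x s)
  thus ?case using assms(1)
    by (cases x) (auto simp: sd_mult_def)
qed (use assms(1) in \<open>simp_all add: sd_eval_append\<close>)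

section \<open>Reduction of words to normal form\<close>

declare word_eq.trans [trans]

lemma word_eq_pow_a_mod:
  assumes "n \<ge> 1"
  shows "word_eq (sd_relations n) (pow_a i) (pow_a (i mod (4 * n)))"
proof -
  have "word_eq (sd_relations n) (pow_a (j + q * (4 * n))) (pow_a j)" for j q
  proof (induction q)
    case 0
    show ?case by (simp add: word_eq.refl)
  next
    case (Suc q)
    have "word_eq (sd_relations n) (pow_a (4 * n) @ pow_a (j + q * (4 * n))) ([] @ pow_a j)"
      by (rule word_eq.append[OF word_eq.relator Suc]) (simp add: sd_relations_def)
    thus ?case by (simp add: pow_a_add[symmetric] algebra_simps)
  qed
  from this[of "i mod (4 * n)" "i div (4 * n)"] show ?thesis by (simp only: mod_div_mult_eq)
qed

lemma word_eq_b_pow_a: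
  "word_eq (sd_relations n) (pow_b 1 @ pow_a i) (pow_a ((2 * n - 1) * i) @ pow_b 1)"
proof (induction i)
  case 0
  show ?case by (simp add: pow_a_def word_eq.refl)
next
  case (Suc i)
  have "word_eq (sd_relations n) ((pow_b 1 @ pow_a 1) @ pow_a i) ((pow_a (2 * n - 1) @ pow_b 1) @ pow_a i)"
    by (rule word_eq.append[OF word_eq.relator word_eq.refl]) (simp add: sd_relations_def)
  also have "word_eq (sd_relations n) ((pow_a (2 * n - 1) @ pow_b 1) @ pow_a i)
      (pow_a (2 * n - 1) @ (pow_a ((2 * n - 1) * i) @ pow_b 1))"
    using word_eq.append[OF word_eq.refl Suc] by simp
  finally show ?case using pow_a_add[of 1 i] by (simp add: pow_a_add)
qed

text \<open>Multiplying by the inverse letter on the left replaces it by a positive word.\<close>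

lemma word_eq_inverse_letter:
  assumes "word_eq R ((x, True) # u) []"
  shows "word_eq R [(x, False)] u"
proof -
  have "word_eq R ([(x, False)] @ []) ([(x, False)] @ ((x, True) # u))"
    by (intro word_eq.append word_eq.refl word_eq.sym[OF assms])
  also have "word_eq R ([(x, False)] @ ((x, True) # u)) ([] @ u)"
    using word_eq.append[OF word_eq.cancel[of R x False] word_eq.refl[of R u]] by simp
  finally show ?thesis by simp
qed

text \<open>The relations suffice to carry out the multiplication rule one letter at a time: a
  letter of type \<open>a\<close> merges into the exponent, while one of type \<open>b\<close> moves
  past \<open>a^i\<close>, twists the exponent and merges with the final \<open>b\<close>.\<close>

lemma word_eq_letter_normal:
  assumes "n \<ge> 1"
  shows "word_eq (sd_relations n) ([l] @ sd_normal (i, s)) (sd_normal (sd_mult n (sd_letter n l) (i, s)))"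
proof -
  let ?R = "sd_relations n" and ?w = "if s then pow_b 1 else []"
  have b2: "word_eq ?R (pow_b 1 @ pow_b 1) []"
    using word_eq.relator[of "pow_b 2" "[]" ?R] by (simp add: sd_relations_def pow_b_def numeral_2_eq_2)
  show ?thesis
  proof (cases l)
    case (Pair x t)
    show ?thesis
    proof (cases x)
      case Gen_a
      define j where "j = (if t then 1 else 4 * n - 1)"
      have "word_eq ?R (pow_a (4 * n)) []" by (rule word_eq.relator) (simp add: sd_relations_def)
      hence "word_eq ?R ((Gen_a, True) # pow_a (4 * n - 1)) []"
        using pow_a_add[of 1 "4 * n - 1"] assms by (simp add: pow_a_def[of "Suc 0"])
      from word_eq_inverse_letter[OF this] have "word_eq ?R [l] (pow_a j)"
        by (cases t) (auto simp: Pair Gen_a j_def pow_a_def word_eq.refl)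
      hence "word_eq ?R ([l] @ (pow_a i @ ?w)) (pow_a j @ (pow_a i @ ?w))"
        by (intro word_eq.append word_eq.refl)
      also have "pow_a j @ (pow_a i @ ?w) = pow_a (j + i) @ ?w" by (simp add: pow_a_add)
      also have "word_eq ?R (pow_a (j + i) @ ?w) (pow_a ((j + i) mod (4 * n)) @ ?w)"
        by (intro word_eq.append word_eq.refl word_eq_pow_a_mod assms)
      finally show ?thesis by (simp add: Pair Gen_a j_def sd_mult_def)
    next
      case Gen_b
      \<comment> \<open>The arriving \<open>b\<close> toggles the final one: two of them cancel by
        \<open>b2\<close>.\<close>
      let ?w' = "if s then [] else pow_b 1" and ?k = "(2 * n - 1) * i"
      have "word_eq ?R ((Gen_b, True) # pow_b 1) []" using b2 by (simp add: pow_b_def)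
      from word_eq_inverse_letter[OF this] have "word_eq ?R [l] (pow_b 1)"
        by (cases t) (auto simp: Pair Gen_b pow_b_def word_eq.refl)
      hence "word_eq ?R ([l] @ (pow_a i @ ?w)) (pow_b 1 @ (pow_a i @ ?w))"
        by (intro word_eq.append word_eq.refl)
      also have "word_eq ?R (pow_b 1 @ (pow_a i @ ?w)) ((pow_a ?k @ pow_b 1) @ ?w)"
        using word_eq.append[OF word_eq_b_pow_a word_eq.refl] by simp
      also have "word_eq ?R ((pow_a ?k @ pow_b 1) @ ?w) (pow_a (?k mod (4 * n)) @ ?w')"
        using word_eq.append[OF word_eq_pow_a_mod[OF assms, of ?k], of "pow_b 1 @ ?w" ?w'] b2
        by (cases s) (auto simp: word_eq.refl)
      finally show ?thesis by (cases s) (simp_all add: Pair Gen_b sd_mult_def)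
    qed
  qed
qed

lemma word_eq_normal:
  assumes "n \<ge> 1"
  shows "word_eq (sd_relations n) u (sd_normal (sd_eval n u))"
proof (induction u)
  case Nil
  show ?case by (simp add: pow_a_def word_eq.refl)
next
  case (Cons l u)
  have "word_eq (sd_relations n) ([l] @ u) ([l] @ sd_normal (sd_eval n u))"
    by (intro word_eq.append word_eq.refl Cons)
  also have "word_eq (sd_relations n) ([l] @ sd_normal (sd_eval n u)) (sd_normal (sd_eval n (l # u)))"
    using word_eq_letter_normal[OF assms] by (cases "sd_eval n u") simp
  finally show ?case by simp
qed

text \<open>Words with equal values are both congruent to the same normal word; the other direction
  is the invariance of \<open>sd_eval\<close>.\<close>

lemma word_eq_iff_sd_eval_eq:
  assumes "n \<ge> 1"
  shows "word_eq (sd_relations n) u v \<longleftrightarrow> sd_eval n u = sd_eval n v"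
  using word_eq_imp_sd_eval_eq[OF assms] word_eq_normal[OF assms]
  by (metis word_eq.sym word_eq.trans)

lemma sd_eval_normal:
  assumes "n \<ge> 1" "i < 4 * n"
  shows "sd_eval n (sd_normal (i, s)) = (i, s)"
  using assms by (auto simp: sd_eval_append sd_eval_pow_a sd_eval_pow_b[simplified] sd_mult_def)

lemma semidihedral_group_model:
  assumes "n \<ge> 1"
  obtains \<phi> where "bij_betw \<phi> (carrier (semidihedral_group n)) ({..<4 * n} \<times> UNIV)"
    and "\<And>x y. x \<in> carrier (semidihedral_group n) \<Longrightarrow> y \<in> carrier (semidihedral_group n) \<Longrightarrow>
      \<phi> (x \<otimes>\<^bsub>semidihedral_group n\<^esub> y) = sd_mult n (\<phi> x) (\<phi> y)"
proof
  let ?W = "word_class (sd_relations n)"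
  have G: "semidihedral_group n = presented_group (sd_relations n)"
    by (simp add: semidihedral_group_def sd_relations_def)
  have carr: "carrier (semidihedral_group n) = range ?W"
    by (simp add: G presented_group_def)
  \<comment> \<open>The choice of representative is harmless, since congruent words have equal
    values.\<close>
  define \<phi> where "\<phi> X = sd_eval n (SOME u. ?W u = X)" for X
  have \<phi>: "\<phi> (?W u) = sd_eval n u" for u
  proof -
    have "?W (SOME v. ?W v = ?W u) = ?W u" by (rule someI) (rule HOL.refl)
    thus ?thesis using assms by (simp add: \<phi>_def word_class_eq_iff word_eq_iff_sd_eval_eq)
  qed
  show "bij_betw \<phi> (carrier (semidihedral_group n)) ({..<4 * n} \<times> UNIV)"
    unfolding bij_betw_def
  proof
    show "inj_on \<phi> (carrier (semidihedral_group n))"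
      using assms by (auto simp: carr inj_on_def \<phi> word_class_eq_iff word_eq_iff_sd_eval_eq)
    have "\<phi> ` carrier (semidihedral_group n) = range (sd_eval n)"
      by (simp add: carr image_image \<phi>)
    also have "\<dots> = {..<4 * n} \<times> UNIV"
    proof (intro equalityI subsetI)
      fix x assume "x \<in> range (sd_eval n)"
      thus "x \<in> {..<4 * n} \<times> UNIV" using sd_eval_bound[OF assms] by (auto simp: mem_Times_iff)
    next
      fix x :: "nat \<times> bool" assume "x \<in> {..<4 * n} \<times> UNIV"
      hence "x = sd_eval n (sd_normal x)" using sd_eval_normal[OF assms] by (cases x) simp
      thus "x \<in> range (sd_eval n)" by blast
    qed
    finally show "\<phi> ` carrier (semidihedral_group n) = {..<4 * n} \<times> UNIV" .
  qed
  show "\<phi> (x \<otimes>\<^bsub>semidihedral_group n\<^esub> y) = sd_mult n (\<phi> x) (\<phi> y)"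
    if "x \<in> carrier (semidihedral_group n)" "y \<in> carrier (semidihedral_group n)" for x y
    using that assms unfolding carr by (auto simp: G presented_group_mult \<phi> sd_eval_append)
qed

text \<open>Twin classes of the commuting graph: \<open>0\<close> is the centre, \<open>1\<close> the noncentral powers of \<open>a\<close>.\<close>

definition sd_kind :: "nat \<Rightarrow> nat \<times> bool \<Rightarrow> nat" where
  "sd_kind n = (\<lambda>(i, s). if s then 2 + i mod (2 * n) else if i mod (2 * n) = 0 then 0 else 1)"

section \<open>Commutation in normal form\<close>

text \<open>The two sides differ by \<open>2 (n-1) (j-i)\<close>. After halving, the factor
  \<open>n-1\<close> cancels: it is coprime to \<open>n\<close>, and odd because \<open>n\<close> is
  even. The offset \<open>k\<close> lets one statement serve all products involving
  \<open>b\<close>.\<close>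

lemma twist_cong_iff:
  fixes n i j k :: nat
  assumes "n \<ge> 1" and "even n"
  shows "[k + i + (2 * n - 1) * j = k + j + (2 * n - 1) * i] (mod (4 * n)) \<longleftrightarrow> [i = j] (mod (2 * n))"
proof -
  have "coprime (int n - 1) (2 * int n)"
  proof -
    have "coprime (int n - 1) (int n)" by simp
    moreover have "coprime (int n - 1) 2" using assms by simp
    ultimately show ?thesis by simp
  qed
  have "[k + i + (2 * n - 1) * j = k + j + (2 * n - 1) * i] (mod (4 * n)) \<longleftrightarrow>
      int (4 * n) dvd int (k + i + (2 * n - 1) * j) - int (k + j + (2 * n - 1) * i)"
    by (simp only: cong_int_iff[symmetric] cong_iff_dvd_diff)
  also have "int (k + i + (2 * n - 1) * j) - int (k + j + (2 * n - 1) * i) =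
      2 * ((int n - 1) * (int j - int i))"
    using assms by (cases n) (simp_all add: algebra_simps)
  also have "int (4 * n) dvd \<dots> \<longleftrightarrow> 2 * (2 * int n) dvd 2 * ((int n - 1) * (int j - int i))"
    by simp
  also have "\<dots> \<longleftrightarrow> 2 * int n dvd (int n - 1) * (int j - int i)"
    by (simp only: dvd_mult_cancel_left) simp
  also have "\<dots> \<longleftrightarrow> 2 * int n dvd int j - int i"
    using \<open>coprime (int n - 1) (2 * int n)\<close>
    by (simp add: coprime_dvd_mult_right_iff coprime_commute)
  also have "\<dots> \<longleftrightarrow> [int j = int i] (mod int (2 * n))" by (simp add: cong_iff_dvd_diff)
  also have "\<dots> \<longleftrightarrow> [i = j] (mod (2 * n))" by (simp only: cong_int_iff cong_sym_eq)
  finally show ?thesis .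
qed

lemma sd_mult_commute_iff:
  assumes "n \<ge> 1" and "even n"
  shows "sd_mult n x y = sd_mult n y x \<longleftrightarrow> sd_kind n x = 0 \<or> sd_kind n y = 0 \<or> sd_kind n x = sd_kind n y"
proof -
  obtain i s j t where xy: "x = (i, s)" "y = (j, t)" by (metis surj_pair)
  show ?thesis
  proof (cases s; cases t)
    assume "s" "t"
    thus ?thesis using twist_cong_iff[OF assms, of 0 i j]
      by (simp add: xy sd_mult_def sd_kind_def cong_def)
  next
    assume "s" "\<not> t"
    \<comment> \<open>With one exponent set to 0 the congruence says that the power of
      \<open>a\<close> is central.\<close>
    thus ?thesis using twist_cong_iff[OF assms, of i 0 j]
      by (auto simp: xy sd_mult_def sd_kind_def cong_def add.commute)
  next
    assume "\<not> s" "t"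
    thus ?thesis using twist_cong_iff[OF assms, of j i 0]
      by (simp add: xy sd_mult_def sd_kind_def cong_def add.commute)
  next
    assume "\<not> s" "\<not> t"
    thus ?thesis by (simp add: xy sd_mult_def sd_kind_def add.commute)
  qed
qed

text \<open>Every residue modulo \<open>2n\<close> has exactly two representatives below
  \<open>4n\<close>.\<close>

lemma card_sd_kind:
  assumes "n \<ge> 1" "\<kappa> < 2 * n + 2"
  shows "card {x \<in> {..<4 * n} \<times> UNIV. sd_kind n x = \<kappa>} = (if \<kappa> = 1 then 4 * n - 2 else 2)"
proof -
  have fib: "{i. i < 4 * n \<and> i mod (2 * n) = j} = {j, j + 2 * n}" if "j < 2 * n" for j
  proof -
    have "i = j \<or> i = j + 2 * n" if "i < 4 * n" "i mod (2 * n) = j" for i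
    proof (cases "i < 2 * n")
      case False
      hence "i mod (2 * n) = i - 2 * n" using that le_mod_geq[of "2 * n" i] by simp
      thus ?thesis using that False by linarith
    qed (use that in simp)
    thus ?thesis using that by auto
  qed
  consider "\<kappa> = 0" | "\<kappa> = 1" | "\<kappa> = 2 + (\<kappa> - 2)" "\<kappa> - 2 < 2 * n"
    using assms(2) by linarith
  thus ?thesis
  proof cases
    case 1
    have "{x \<in> {..<4 * n} \<times> UNIV. sd_kind n x = \<kappa>} = {i. i < 4 * n \<and> i mod (2 * n) = 0} \<times> {False}"
      by (auto simp: 1 sd_kind_def split: if_splits)
    thus ?thesis using fib[of 0] assms 1 by (simp add: card_cartesian_product)
  next
    case 2
    have "{x \<in> {..<4 * n} \<times> UNIV. sd_kind n x = \<kappa>} =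
        ({..<4 * n} - {i. i < 4 * n \<and> i mod (2 * n) = 0}) \<times> {False}"
      by (auto simp: 2 sd_kind_def split: if_splits)
    thus ?thesis using fib[of 0] assms 2 by (simp add: card_cartesian_product card_Diff_subset)
  next
    case 3
    then obtain j where j: "\<kappa> = 2 + j" "j < 2 * n" by blast
    have "{x \<in> {..<4 * n} \<times> UNIV. sd_kind n x = \<kappa>} = {i. i < 4 * n \<and> i mod (2 * n) = j} \<times> {True}"
      by (auto simp: j sd_kind_def split: if_splits)
    thus ?thesis using fib[of j] assms j by (simp add: card_cartesian_product)
  qed
qed

section \<open>The resolving polynomial\<close>

lemma coeff_one_two_power: "coeff ([:1, 2 :: nat:] ^ N) k = 2 ^ k * (N choose k)"
proof (cases "k \<le> N")
  case True
  thus ?thesis by (simp add: coeff_linear_poly_power)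
next
  case False
  moreover have "degree ([:1, 2 :: nat:] ^ N) \<le> N"
    using degree_power_le[of "[:1, 2 :: nat:]" N] by simp
  ultimately show ?thesis by (simp add: coeff_eq_0)
qed

text \<open>Since \<open>4n-2 = 2 (2n-1)\<close>, the linear factor supplies the power of 2 missing
  from the shifted coefficient. The case \<open>k = 0\<close> is separate because
  \<open>k - 1\<close> truncates to 0 there and would count a spurious term.\<close>

lemma coeff_partial_transversal_poly:
  fixes n N k :: nat
  assumes "n \<ge> 1"
  shows "coeff ([:1, 4 * n - 2:] * [:1, 2:] ^ N) k =
    (if k = 0 then 1 else 2 ^ k * ((N choose k) + (2 * n - 1) * (N choose (k - 1))))"
proof (cases k)
  case 0
  thus ?thesis using coeff_one_two_power[of N 0] by simp
next
  case (Suc j)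
  obtain h where h: "2 * n - 1 = h" by blast
  hence "4 * n - 2 = 2 * h" by simp
  thus ?thesis using Suc unfolding h
    by (simp add: coeff_one_two_power[simplified] algebra_simps)
qed

lemma sd_kind_less: "n \<ge> 1 \<Longrightarrow> sd_kind n x < 2 * n + 2"
  by (auto simp: sd_kind_def split: prod.splits)

lemma num_resolving_sets_semidihedral:
  fixes n i :: nat
  assumes n: "n \<ge> 2" "even n"
  defines "\<Gamma> \<equiv> commuting_graph (semidihedral_group n)"
  shows "card (pverts \<Gamma>) = 8 * n"
    and "i \<le> 8 * n \<Longrightarrow> num_resolving_sets \<Gamma> i =
      coeff ([:1, 4 * n - 2:] * [:1, 2:] ^ (2 * n + 1)) (8 * n - i)"
proof -
  let ?G = "semidihedral_group n" and ?M = "{..<4 * n} \<times> (UNIV :: bool set)"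
  have n1: "n \<ge> 1" using n by simp
  obtain \<phi> where bij: "bij_betw \<phi> (carrier ?G) ?M"
    and mult: "\<And>x y. x \<in> carrier ?G \<Longrightarrow> y \<in> carrier ?G \<Longrightarrow>
      \<phi> (x \<otimes>\<^bsub>?G\<^esub> y) = sd_mult n (\<phi> x) (\<phi> y)"
    using semidihedral_group_model[OF n1] by blast
  interpret group ?G unfolding semidihedral_group_def by (rule group_presented_group)
  have verts: "pverts \<Gamma> = carrier ?G" by (simp add: \<Gamma>_def commuting_graph_def)
  define c where "c x = sd_kind n (\<phi> x)" for x
  define K where "K = {..<2 * n + 2}"
  have comm: "x \<otimes>\<^bsub>?G\<^esub> y = y \<otimes>\<^bsub>?G\<^esub> x \<longleftrightarrow> c x = 0 \<or> c y = 0 \<or> c x = c y"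
    if "x \<in> carrier ?G" "y \<in> carrier ?G" for x y
  proof -
    have "x \<otimes>\<^bsub>?G\<^esub> y = y \<otimes>\<^bsub>?G\<^esub> x \<longleftrightarrow> \<phi> (x \<otimes>\<^bsub>?G\<^esub> y) = \<phi> (y \<otimes>\<^bsub>?G\<^esub> x)"
      using bij that by (auto simp: bij_betw_def dest: inj_onD)
    thus ?thesis using that n by (simp add: mult sd_mult_commute_iff c_def)
  qed
  have fibre: "card {x \<in> carrier ?G. c x = \<kappa>} = (if \<kappa> = 1 then 4 * n - 2 else 2)" if "\<kappa> \<in> K" for \<kappa>
  proof -
    have "{y \<in> ?M. sd_kind n y = \<kappa>} = {y \<in> \<phi> ` carrier ?G. sd_kind n y = \<kappa>}"
      using bij by (simp only: bij_betw_def)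
    also have "\<dots> = \<phi> ` {x \<in> carrier ?G. c x = \<kappa>}" by (auto simp: c_def)
    finally have "card {y \<in> ?M. sd_kind n y = \<kappa>} = card {x \<in> carrier ?G. c x = \<kappa>}"
      using bij by (auto simp: bij_betw_def intro!: card_image intro: inj_on_subset)
    thus ?thesis using card_sd_kind[OF n1, of \<kappa>] that by (simp add: K_def)
  qed
  have cK: "c x \<in> K" for x using sd_kind_less[OF n1] by (simp add: c_def K_def)
  have res: "resolving_set \<Gamma> U \<longleftrightarrow> U \<subseteq> pverts \<Gamma> \<and> inj_on c (pverts \<Gamma> - U)" for U
    unfolding verts unfolding \<Gamma>_def
  proof (rule resolving_set_commuting_graph_iff[where k = 0])
    show "\<exists>y\<in>carrier ?G. y \<noteq> x \<and> c y = c x" if "x \<in> carrier ?G" for x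
    proof (rule ccontr)
      assume "\<not> ?thesis"
      hence "{y \<in> carrier ?G. c y = c x} \<subseteq> {x}" by blast
      \<comment> \<open>This contradicts the fibre sizes, which are 2 or
        \<open>4n-2\<close>.\<close>
      hence "card {y \<in> carrier ?G. c y = c x} \<le> 1" using card_mono[of "{x}"] by fastforce
      thus False using fibre[OF cK[of x]] n by (auto split: if_splits)
    qed
    show "\<exists>y\<in>carrier ?G. c y \<noteq> 0 \<and> c y \<noteq> c x" for x
    proof -
      \<comment> \<open>Labels 1 and 2 both belong to nonempty noncentral classes; the one different
        from \<open>c x\<close> is taken.\<close>
      define \<kappa> where "\<kappa> = (if c x = 1 then 2 else (1 :: nat))"
      have "card {y \<in> carrier ?G. c y = \<kappa>} \<noteq> 0"
        using fibre[of \<kappa>] n by (auto simp: \<kappa>_def K_def)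
      hence "{y \<in> carrier ?G. c y = \<kappa>} \<noteq> {}" by (metis card.empty)
      moreover have "\<kappa> \<noteq> 0" "\<kappa> \<noteq> c x" by (auto simp: \<kappa>_def)
      ultimately show ?thesis by blast
    qed
  qed (use comm is_group in auto)
  show card: "card (pverts \<Gamma>) = 8 * n"
    using bij_betw_same_card[OF bij] by (simp add: verts card_cartesian_product)
  have fin: "finite (pverts \<Gamma>)" using bij_betw_finite[OF bij] by (simp add: verts)
  assume "i \<le> 8 * n"
  hence "num_resolving_sets \<Gamma> i =
      coeff (\<Prod>\<kappa>\<in>K. [:1, card {x \<in> pverts \<Gamma>. c x = \<kappa>}:]) (8 * n - i)"
    using num_resolving_sets_eq_coeff[OF res fin, of K i] cK card by (auto simp: K_def)
  also have "(\<Prod>\<kappa>\<in>K. [:1, card {x \<in> pverts \<Gamma>. c x = \<kappa>}:]) =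
      (\<Prod>\<kappa>\<in>K. [:1, if \<kappa> = 1 then 4 * n - 2 else 2:])"
    by (intro prod.cong) (simp_all add: verts fibre)
  \<comment> \<open>Splitting off label 1 leaves \<open>2n+1\<close> classes of two elements, the
    centre among them.\<close>
  also have "\<dots> = [:1, 4 * n - 2:] * (\<Prod>\<kappa>\<in>K - {1}. [:1, if \<kappa> = 1 then 4 * n - 2 else 2:])"
    by (subst prod.remove[of K 1]) (auto simp: K_def)
  also have "(\<Prod>\<kappa>\<in>K - {1}. [:1, if \<kappa> = 1 then 4 * n - 2 else 2:]) = (\<Prod>\<kappa>\<in>K - {1}. [:1, 2:])"
    by (intro prod.cong) auto
  also have "\<dots> = [:1, 2:] ^ (2 * n + 1)" by (simp add: K_def)
  finally show "num_resolving_sets \<Gamma> i =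
      coeff ([:1, 4 * n - 2:] * [:1, 2:] ^ (2 * n + 1)) (8 * n - i)" .
qed

lemma metric_dim_eqI:
  assumes "finite (pverts \<Gamma>)" and "num_resolving_sets \<Gamma> d \<noteq> 0"
    and "\<And>i. i < d \<Longrightarrow> num_resolving_sets \<Gamma> i = 0"
  shows "metric_dim \<Gamma> = d"
  unfolding metric_dim_def
proof (rule Least_equality)
  have "{U. resolving_set \<Gamma> U \<and> finite U \<and> card U = d} \<noteq> {}"
    using assms(2) unfolding num_resolving_sets_def by (metis card.empty)
  thus "\<exists>U. resolving_set \<Gamma> U \<and> finite U \<and> card U = d" by blast
next
  fix k assume k: "\<exists>U. resolving_set \<Gamma> U \<and> finite U \<and> card U = k"
  \<comment> \<open>Without finiteness a count of 0 could be the default value of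
    \<open>card\<close> and would not mean that no set exists.\<close>
  have "finite {U. resolving_set \<Gamma> U \<and> finite U \<and> card U = k}"
    by (rule finite_subset[of _ "Pow (pverts \<Gamma>)"]) (use assms(1) in \<open>auto simp: resolving_set_def\<close>)
  hence "num_resolving_sets \<Gamma> k \<noteq> 0" using k by (auto simp: num_resolving_sets_def)
  thus "d \<le> k" using assms(3)[of k] by (meson not_le)
qed

theorem theorem4p27:
  fixes n :: nat and r :: "nat \<Rightarrow> nat"
  assumes "n \<ge> 2" and "even n"
    and r: "\<And>i. 6 * n - 1 \<le> i \<Longrightarrow> i \<le> 8 * n - 2 \<Longrightarrow>
      r i = 2 ^ (8 * n - i) *
        (((2 * n + 1) choose (8 * n - i)) + (2 * n - 1) * ((2 * n + 1) choose (8 * n - i - 1)))"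
  shows "resolving_poly (commuting_graph (semidihedral_group n)) =
      monom 1 (8 * n) + monom (int (8 * n)) (8 * n - 1)
      + monom (int (2 ^ (2 * n + 2) * (2 * n - 1))) (6 * n - 2)
      + (\<Sum>i = 6 * n - 1..8 * n - 2. monom (int (r i)) i)"
proof -
  define \<Gamma> where "\<Gamma> = commuting_graph (semidihedral_group n)"
  define N where "N = num_resolving_sets \<Gamma>"
  have n1: "n \<ge> 1" using assms by simp
  have card: "card (pverts \<Gamma>) = 8 * n"
    using num_resolving_sets_semidihedral(1)[OF assms(1,2)] by (simp add: \<Gamma>_def)
  \<comment> \<open>The exception at \<open>i = 8n\<close> is the constant coefficient, where the
    subtraction of 1 would truncate.\<close>
  have N: "N i = (if i = 8 * n then 1 else 2 ^ (8 * n - i) *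
      (((2 * n + 1) choose (8 * n - i)) + (2 * n - 1) * ((2 * n + 1) choose (8 * n - i - 1))))"
    if "i \<le> 8 * n" for i
    unfolding N_def \<Gamma>_def num_resolving_sets_semidihedral(2)[OF assms(1,2) that]
      coeff_partial_transversal_poly[OF n1] using that by simp
  have N_values: "N (8 * n) = 1" "N (8 * n - 1) = 8 * n"
    "N (6 * n - 2) = 2 ^ (2 * n + 2) * (2 * n - 1)"
  proof -
    show "N (8 * n) = 1" by (simp add: N)
    have "8 * n - (8 * n - 1) = 1" using n1 by simp
    thus "N (8 * n - 1) = 8 * n" using n1 by (simp add: N)
    \<comment> \<open>Here the complement takes one element from each of the \<open>2n+2\<close>
      classes: the first binomial vanishes and the second is 1.\<close>
    have "8 * n - (6 * n - 2) = 2 * n + 2" "6 * n - 2 \<noteq> 8 * n" using n1 by linarith+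
    thus "N (6 * n - 2) = 2 ^ (2 * n + 2) * (2 * n - 1)" using n1 by (simp add: N binomial_eq_0)
  qed
  have "metric_dim \<Gamma> = 6 * n - 2"
  proof (rule metric_dim_eqI)
    show "finite (pverts \<Gamma>)" using card n1 by (intro card_ge_0_finite) simp
    show "num_resolving_sets \<Gamma> (6 * n - 2) \<noteq> 0" using N_values(3) n1 by (simp add: N_def)
    \<comment> \<open>The complement would have more than \<open>2n+2\<close> elements, so both
      binomials vanish.\<close>
    show "num_resolving_sets \<Gamma> i = 0" if "i < 6 * n - 2" for i
      using N[of i] that by (simp add: N_def binomial_eq_0)
  qed
  hence "resolving_poly \<Gamma> = (\<Sum>i = 6 * n - 2..8 * n. monom (int (N i)) i)"
    by (simp add: resolving_poly_def card N_def)
  also have "{6 * n - 2..8 * n} = {6 * n - 2, 8 * n - 1, 8 * n} \<union> {6 * n - 1..8 * n - 2}"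
    using n1 by auto
  also have "(\<Sum>i\<in>\<dots>. monom (int (N i)) i) =
      (\<Sum>i\<in>{6 * n - 2, 8 * n - 1, 8 * n}. monom (int (N i)) i) + (\<Sum>i = 6 * n - 1..8 * n - 2. monom (int (N i)) i)"
    using n1 by (intro sum.union_disjoint) auto
  also have "(\<Sum>i\<in>{6 * n - 2, 8 * n - 1, 8 * n}. monom (int (N i)) i) =
      monom 1 (8 * n) + monom (int (8 * n)) (8 * n - 1)
      + monom (int (2 ^ (2 * n + 2) * (2 * n - 1))) (6 * n - 2)"
  proof -
    have "6 * n - 2 \<noteq> 8 * n - 1" "6 * n - 2 \<noteq> 8 * n" "8 * n - 1 \<noteq> 8 * n" using n1 by linarith+
    thus ?thesis by (simp add: N_values add_ac del: One_nat_def of_nat_mult of_nat_power)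
  qed
  also have "(\<Sum>i = 6 * n - 1..8 * n - 2. monom (int (N i)) i) =
      (\<Sum>i = 6 * n - 1..8 * n - 2. monom (int (r i)) i)"
  proof (intro sum.cong HOL.refl)
    fix i assume "i \<in> {6 * n - 1..8 * n - 2}"
    hence i: "6 * n - 1 \<le> i" "i \<le> 8 * n - 2" by simp_all
    hence "i \<le> 8 * n" "i \<noteq> 8 * n" using n1 by linarith+
    hence "N i = r i" by (simp only: N r[OF i] if_False)
    thus "monom (int (N i)) i = monom (int (r i)) i" by simp
  qed
  finally show ?thesis by (simp only: \<Gamma>_def)
qed

end
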